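(* For every integer $k\geq 3$, the odd graph $O_k=K(2k+1,k)$ has a Hamilton cycle.
   Context: For integers $k\geq 1$ and $n\geq 2k+1$, the Kneser graph $K(n,k)$ is the graph whose vertices are the $k$-element subsets of $[n]=\{1,\ldots,n\}$, two subsets being adjacent if and only if they are disjoint. The odd graph is $O_k:=K(2k+1,k)$. *)

theory Defs
  imports "Graph_Theory.Pair_Digraph"
begin

(* An undirected simple graph is a pair_graph: a finite loop-free digraph with symmetric arc set. *)

definition kneser_graph :: "nat \<Rightarrow> nat \<Rightarrow> nat set pair_pre_digraph" where
  "kneser_graph n k =
     \<lparr> pverts = {A. A \<subseteq> {1..n} \<and> card A = k},
       parcs = {(A, B). A \<subseteq> {1..n} \<and> card A = k \<and> B \<subseteq> {1..n} \<and> card B = k \<and> A \<inter> B = {}} \<rparr>"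

definition odd_graph :: "nat \<Rightarrow> nat set pair_pre_digraph" where
  "odd_graph k = kneser_graph (2 * k + 1) k"

(* In a symmetric digraph, cycle also admits u, v, u, which traverses one undirected edge
   back and forth; the bound on the length excludes this. The vertices visited by a closed
   walk are the tails of its arcs. *)
definition (in pre_digraph) hamilton_cycle :: "'b awalk \<Rightarrow> bool" where
  "hamilton_cycle p \<longleftrightarrow> cycle p \<and> 3 \<le> length p \<and> tail G ` set p = verts G"

lemma pair_graph_kneser_graph:
  assumes "k \<ge> 1"
  shows "pair_graph (kneser_graph n k)"
proof
  let ?V = "{A. A \<subseteq> {1..n} \<and> card A = k}"
  have V: "pverts (kneser_graph n k) = ?V"
    by (simp add: kneser_graph_def)
  have arcs: "e \<in> parcs (kneser_graph n k) \<longleftrightarrow>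
      fst e \<in> ?V \<and> snd e \<in> ?V \<and> fst e \<inter> snd e = {}" for e
    unfolding kneser_graph_def by (cases e) simp
  have fin: "finite ?V"
    by (rule finite_subset[of _ "Pow {1..n}"]) blast+
  show "finite (pverts (kneser_graph n k))"
    unfolding V by (rule fin)
  have "parcs (kneser_graph n k) \<subseteq> ?V \<times> ?V"
    by (rule subsetI) (simp only: arcs mem_Times_iff)
  then show "finite (parcs (kneser_graph n k))"
    by (rule finite_subset) (rule finite_cartesian_product[OF fin fin])
  have "sym (parcs (kneser_graph n k))"
    by (rule symI) (simp add: arcs Int_commute)
  then show "symmetric (with_proj (kneser_graph n k))"
    by (simp add: symmetric_def)
  show "fst e \<in> pverts (kneser_graph n k)" if "e \<in> parcs (kneser_graph n k)" for e
    using that unfolding arcs V by (elim conjE)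
  show "snd e \<in> pverts (kneser_graph n k)" if "e \<in> parcs (kneser_graph n k)" for e
    using that unfolding arcs V by (elim conjE)
  show "fst e \<noteq> snd e" if "e \<in> parcs (kneser_graph n k)" for e
  proof
    assume "fst e = snd e"
    with that have "snd e = {}"
      unfolding arcs by simp
    moreover have "card (snd e) = k"
      using that unfolding arcs by simp
    ultimately show False
      using assms by simp
  qed
qed

end

theory Submission
  imports Defs "Graph_Theory.Vertex_Walk"
begin

text \<open>
  Drop the element \<open>2k + 1\<close> from the ground set, and complement the vertices that contain it: the vertices
  become the 0/1-words of length \<open>2k\<close> with \<open>k\<close> or \<open>k + 1\<close> ones, and two of them are adjacent if one
  arises from the other by flipping a single bit, or if they are complementary words with \<open>k\<close> ones.

  Every Dyck word of length \<open>2k\<close> is joined to its complement by a path defined by recursion on the binary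
  tree of the word. These paths partition the words, so closing each of them by the edge between
  complementary words gives a 2-factor, whose cycles are indexed by the binary trees with \<open>k\<close> nodes.

  An alternating 6-cycle (8-cycle) of the graph that shares every second edge with three (four) different
  cycles glues these into one. The path of \<open>Node w v\<close> contains copies of the paths of \<open>w\<close> and of \<open>v\<close>, so
  alternating cycles for trees \<open>w\<close> carry over to the trees \<open>Node w v\<close> with fixed \<open>v\<close>, and vice versa. The
  cycles are attached in the order of the size of \<open>w\<close>, for one \<open>v\<close> after the other, by 6-cycles that
  consume two components at a time; therefore the induction runs simultaneously over gluings into one
  cycle and gluings into two cycles that separate two prescribed trees. Only the two trees of size 2
  cannot be glued.
\<close>

section \<open>Gluing disjoint cycles along alternating cycles\<close>

text \<open>
  A family of disjoint cycles is indexed by \<open>'t\<close>; some of their edges form the type \<open>'e\<close>, and each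
  of these has a lower and an upper end. The relation \<open>feeds e f\<close> stands for an additional edge from the
  upper end of \<open>e\<close> to the lower end of \<open>f\<close>. Then \<open>glued owner feeds X A\<close> says that the cycles in \<open>X\<close>
  can be glued to a single cycle that still contains all edges in \<open>A\<close>, and \<open>glued_path owner feeds X A e f\<close>
  is the analogue for a path from the lower end of \<open>e\<close> to the upper end of \<open>f\<close>.
\<close>
inductive glued :: "('e \<Rightarrow> 't) \<Rightarrow> ('e \<Rightarrow> 'e \<Rightarrow> bool) \<Rightarrow> 't set \<Rightarrow> 'e set \<Rightarrow> bool"
  and glued_path :: "('e \<Rightarrow> 't) \<Rightarrow> ('e \<Rightarrow> 'e \<Rightarrow> bool) \<Rightarrow> 't set \<Rightarrow> 'e set \<Rightarrow> 'e \<Rightarrow> 'e \<Rightarrow> bool"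
  for owner :: "'e \<Rightarrow> 't" and feeds :: "'e \<Rightarrow> 'e \<Rightarrow> bool" where
  glued_single: "A \<subseteq> owner -` {t} \<Longrightarrow> glued owner feeds {t} A"
| glued_path_open: "glued owner feeds X (insert e A) \<Longrightarrow> e \<notin> A \<Longrightarrow> glued_path owner feeds X A e e"
| glued_path_join: "glued_path owner feeds X A e f \<Longrightarrow> glued_path owner feeds X' A' e' f' \<Longrightarrow>
    X \<inter> X' = {} \<Longrightarrow> feeds f e' \<Longrightarrow> glued_path owner feeds (X \<union> X') (A \<union> A') e f'"
| glued_close: "glued_path owner feeds X A e f \<Longrightarrow> feeds f e \<Longrightarrow> glued owner feeds X A"

lemma glued_subset_vimage:
  "glued owner feeds X A \<Longrightarrow> A \<subseteq> owner -` X"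
  "glued_path owner feeds X A e f \<Longrightarrow> A \<subseteq> owner -` X"
  by (induction rule: glued_glued_path.inducts) auto

lemma glued_antimono:
  "glued owner feeds X A \<Longrightarrow> B \<subseteq> A \<Longrightarrow> glued owner feeds X B"
  "glued_path owner feeds X A e f \<Longrightarrow> B \<subseteq> A \<Longrightarrow> glued_path owner feeds X B e f"
proof (induction arbitrary: B and B rule: glued_glued_path.inducts)
  case (glued_single A t)
  then show ?case by (intro glued_glued_path.glued_single) blast
next
  case (glued_path_open X e A)
  then show ?case by (intro glued_glued_path.glued_path_open) blast+
next
  case (glued_path_join X A e f X' A' e' f')
  have "glued_path owner feeds (X \<union> X') (B \<inter> A \<union> B \<inter> A') e f'"
    using glued_path_join by (intro glued_glued_path.glued_path_join) auto
  moreover have "B \<inter> A \<union> B \<inter> A' = B"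
    using glued_path_join.prems by blast
  ultimately show ?case by simp
next
  case (glued_close X A e f)
  then show ?case by (intro glued_glued_path.glued_close[of _ _ X B e f])
qed

lemma glued_conversep:
  "glued owner feeds X A \<Longrightarrow> glued owner feeds\<inverse>\<inverse> X A"
  "glued_path owner feeds X A e f \<Longrightarrow> glued_path owner feeds\<inverse>\<inverse> X A f e"
proof (induction rule: glued_glued_path.inducts)
  case (glued_path_join X A e f X' A' e' f')
  have "glued_path owner feeds\<inverse>\<inverse> (X' \<union> X) (A' \<union> A) f' e"
    by (rule glued_glued_path.glued_path_join[OF glued_path_join.IH(4,2)])
      (use glued_path_join in auto)
  then show ?case by (simp only: Un_commute)
qed (auto intro: glued_glued_path.intros)

lemma glued_image:
  assumes f: "inj f" and g: "inj g" and owner: "\<And>e. owner' (g e) = f (owner e)"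
    and feeds: "\<And>e e'. feeds e e' \<Longrightarrow> feeds' (g e) (g e')"
  shows "glued owner feeds X A \<Longrightarrow> B \<subseteq> owner' -` f ` X \<Longrightarrow> g -` B \<subseteq> A \<Longrightarrow>
      glued owner' feeds' (f ` X) B"
    and "glued_path owner feeds X A d e \<Longrightarrow> B \<subseteq> owner' -` f ` X \<Longrightarrow> g -` B \<subseteq> A \<Longrightarrow>
      glued_path owner' feeds' (f ` X) B (g d) (g e)"
proof (induction arbitrary: B and B rule: glued_glued_path.inducts)
  case (glued_single A t)
  then show ?case by (auto intro: glued_glued_path.glued_single)
next
  case (glued_path_open X e A)
  have "e \<in> owner -` X"
    using glued_subset_vimage(1) glued_path_open by blast
  then have "glued owner' feeds' (f ` X) (insert (g e) B)"
    using glued_path_open.prems by (intro glued_path_open.IH) (auto simp: owner inj_eq[OF g])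
  then show ?case
    using glued_path_open by (intro glued_glued_path.glued_path_open) auto
next
  case (glued_path_join X A d e X' A' d' e')
  let ?C = "\<lambda>Z. B \<inter> owner' -` f ` Z"
  have "glued_path owner' feeds' (f ` X \<union> f ` X') (?C X \<union> ?C X') (g d) (g e')"
  proof (rule glued_glued_path.glued_path_join)
    have "A \<subseteq> owner -` X" "A' \<subseteq> owner -` X'"
      using glued_path_join.IH(1,3) by (simp_all add: glued_subset_vimage)
    then show "glued_path owner' feeds' (f ` X) (?C X) (g d) (g e)"
        "glued_path owner' feeds' (f ` X') (?C X') (g d') (g e')"
      using glued_path_join.prems glued_path_join.hyps(1)
      by (auto intro!: glued_path_join.IH(2,4) simp: owner inj_eq[OF f]) blast+
    show "f ` X \<inter> f ` X' = {}"
      using glued_path_join.hyps(1) f by (simp add: image_Int[symmetric])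
    show "feeds' (g e) (g d')"
      using glued_path_join by (intro feeds)
  qed
  moreover have "?C X \<union> ?C X' = B"
    using glued_path_join.prems(1) by auto
  ultimately show ?case by (simp add: image_Un)
next
  case (glued_close X A d e)
  then show ?case by (blast intro: feeds glued_glued_path.glued_close)
qed

lemma glued_Un3:
  assumes X: "glued owner feeds X (insert e A)" and Y: "glued owner feeds Y (insert f B)"
    and Z: "glued owner feeds Z (insert g C)"
    and feeds: "feeds e f" "feeds f g" "feeds g e"
    and new: "e \<notin> A" "f \<notin> B" "g \<notin> C"
    and disjoint: "X \<inter> Y = {}" "X \<inter> Z = {}" "Y \<inter> Z = {}"
  shows "glued owner feeds (X \<union> Y \<union> Z) (A \<union> B \<union> C)"
proof (rule glued_close)
  note path = glued_path_open[OF X new(1)] glued_path_open[OF Y new(2)] glued_path_open[OF Z new(3)]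
  show "glued_path owner feeds (X \<union> Y \<union> Z) (A \<union> B \<union> C) e g"
    by (rule glued_path_join[OF glued_path_join[OF path(1,2)] path(3)])
      (use feeds disjoint in auto)
qed fact

lemma glued_path_singles:
  assumes "glued_path owner feeds X A e f" "successively feeds (f # gs)" "distinct (map owner gs)"
    and "X \<inter> owner ` set gs = {}"
  shows "glued_path owner feeds (X \<union> owner ` set gs)
    (A \<union> (owner -` owner ` set gs - set gs)) e (last (f # gs))"
  using assms
proof (induction gs arbitrary: X A f)
  case (Cons g gs)
  let ?B = "owner -` {owner g} - {g}"
  have "glued owner feeds {owner g} (insert g ?B)"
    by (rule glued_single) auto
  then have "glued_path owner feeds {owner g} ?B g g"
    by (rule glued_path_open) simp
  then have "glued_path owner feeds (X \<union> {owner g}) (A \<union> ?B) e g"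
    using Cons.prems by (intro glued_path_join[of _ _ X A e f]) auto
  from Cons.IH[OF this] Cons.prems
  have "glued_path owner feeds (X \<union> {owner g} \<union> owner ` set gs)
      (A \<union> ?B \<union> (owner -` owner ` set gs - set gs)) e (last (g # gs))"
    by auto
  moreover have "A \<union> ?B \<union> (owner -` owner ` set gs - set gs) =
      A \<union> (owner -` owner ` set (g # gs) - set (g # gs))"
    using Cons.prems(3) by (auto simp: rev_image_eqI)
  ultimately show ?case by (simp add: Un_assoc)
qed simp

text \<open>
  Starting from a single cycle \<open>X\<close> from which the edges \<open>U\<close> have been removed, each list in the sequence
  glues the single cycles of its tail to the cycle that owns its head.
\<close>
primrec gluing_sequence ::
    "('e \<Rightarrow> 't) \<Rightarrow> ('e \<Rightarrow> 'e \<Rightarrow> bool) \<Rightarrow> 't set \<Rightarrow> 'e set \<Rightarrow> 'e list list \<Rightarrow> bool" where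
  "gluing_sequence owner feeds X U [] \<longleftrightarrow> True"
| "gluing_sequence owner feeds X U (es # ess) \<longleftrightarrow>
     es \<noteq> [] \<and> owner (hd es) \<in> X \<and> hd es \<notin> U \<and>
     distinct (map owner (tl es)) \<and> X \<inter> owner ` set (tl es) = {} \<and>
     successively feeds es \<and> feeds (last es) (hd es) \<and>
     gluing_sequence owner feeds (X \<union> owner ` set (tl es)) (U \<union> set es) ess"

lemma glued_gluing_sequence:
  assumes "glued owner feeds X (owner -` X - U)" "gluing_sequence owner feeds X U ess"
  shows "glued owner feeds (X \<union> owner ` set (concat ess))
    (owner -` (X \<union> owner ` set (concat ess)) - (U \<union> set (concat ess)))"
  using assms
proof (induction ess arbitrary: X U)
  case (Cons es ess)
  then obtain e gs where es: "es = e # gs" by (cases es) auto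
  let ?X = "X \<union> owner ` set gs"
  have "glued owner feeds X (insert e (owner -` X - U - {e}))"
    using Cons.prems es by (intro glued_antimono(1)[OF Cons.prems(1)]) auto
  then have "glued_path owner feeds X (owner -` X - U - {e}) e e"
    by (rule glued_path_open) simp
  then have "glued_path owner feeds ?X
      (owner -` X - U - {e} \<union> (owner -` owner ` set gs - set gs)) e (last (e # gs))"
    using Cons.prems(2) es by (intro glued_path_singles) auto
  then have "glued owner feeds ?X (owner -` X - U - {e} \<union> (owner -` owner ` set gs - set gs))"
    using Cons.prems(2) es by (intro glued_close[of _ _ _ _ e "last (e # gs)"]) auto
  then have "glued owner feeds ?X (owner -` ?X - (U \<union> set es))"
    by (rule glued_antimono) (auto simp: es)
  from Cons.IH[OF this] Cons.prems(2) show ?case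
    by (simp add: es Un_assoc image_Un insert_absorb)
qed simp

definition path_edges :: "'a list \<Rightarrow> 'a set set" where
  "path_edges l = (\<lambda>(x, y). {x, y}) ` set (vwalk_arcs l)"

definition cycle_edges :: "'a list \<Rightarrow> 'a set set" where
  "cycle_edges l = path_edges (l @ [hd l])"

lemma path_edges_simps [simp]:
  "path_edges [] = {}" "path_edges [x] = {}"
  "path_edges (x # y # l) = insert {x, y} (path_edges (y # l))"
  by (simp_all add: path_edges_def)

lemma path_edges_append:
  "l \<noteq> [] \<Longrightarrow> l' \<noteq> [] \<Longrightarrow>
    path_edges (l @ l') = insert {last l, hd l'} (path_edges l \<union> path_edges l')"
  by (simp add: path_edges_def vwalk_arcs_append image_Un)

lemma path_edges_Cons: "l \<noteq> [] \<Longrightarrow> path_edges (x # l) = insert {x, hd l} (path_edges l)"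
  using path_edges_append[of "[x]" l] by simp

lemma cycle_edges_conv: "l \<noteq> [] \<Longrightarrow> cycle_edges l = insert {last l, hd l} (path_edges l)"
  by (simp add: cycle_edges_def path_edges_append)

lemma path_edges_rev: "path_edges (rev l) = path_edges l"
proof (induction l)
  case (Cons x l)
  then show ?case
    by (cases "l = []") (simp_all add: path_edges_append path_edges_Cons last_rev insert_commute)
qed simp

lemma path_edges_map: "path_edges (map f l) = (`) f ` path_edges l"
  by (induction l rule: vwalk_arcs.induct) auto

lemma cycle_edges_map: "l \<noteq> [] \<Longrightarrow> cycle_edges (map f l) = (`) f ` cycle_edges l"
  using path_edges_map[of f "l @ [hd l]"] by (simp add: cycle_edges_def hd_map)

lemma cycle_edges_rev: "cycle_edges (rev l) = cycle_edges l"
  by (cases "l = []")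
    (simp_all add: cycle_edges_conv path_edges_rev hd_rev last_rev insert_commute[of "hd l"])

lemma cycle_edges_append_commute:
  "l \<noteq> [] \<Longrightarrow> l' \<noteq> [] \<Longrightarrow> cycle_edges (l' @ l) = cycle_edges (l @ l')"
  by (auto simp: cycle_edges_conv path_edges_append)

lemma Union_path_edges_subset: "\<Union> (path_edges l) \<subseteq> set l"
  by (induction l rule: vwalk_arcs.induct) auto

lemma Union_cycle_edges_subset: "l \<noteq> [] \<Longrightarrow> \<Union> (cycle_edges l) \<subseteq> set l"
  using Union_path_edges_subset[of l] by (simp add: cycle_edges_conv)

lemma path_edges_elim:
  assumes "s \<in> path_edges l"
  obtains a b where "l = a @ b" "a \<noteq> []" "b \<noteq> []" "s = {last a, hd b}"
  using assms
proof (induction l arbitrary: thesis)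
  case (Cons x l)
  then have "l \<noteq> []" by auto
  show ?case
  proof (cases "s = {x, hd l}")
    case True
    then show ?thesis using Cons.prems(1)[of "[x]" l] \<open>l \<noteq> []\<close> by simp
  next
    case False
    then have "s \<in> path_edges l"
      using Cons.prems(2) \<open>l \<noteq> []\<close> by (simp add: path_edges_Cons)
    from Cons.IH[OF _ this] obtain a b where "l = a @ b" "a \<noteq> []" "b \<noteq> []" "s = {last a, hd b}"
      by blast
    then show ?thesis using Cons.prems(1)[of "x # a" b] by simp
  qed
qed simp

lemma cycle_edges_rotate:
  assumes "{p, q} \<in> cycle_edges l" "l \<noteq> []"
  obtains l' where "l' \<noteq> []" "set l' = set l" "distinct l' = distinct l"
    "cycle_edges l' = cycle_edges l" "hd l' = p" "last l' = q"
proof -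
  have "\<exists>l'. l' \<noteq> [] \<and> set l' = set l \<and> distinct l' = distinct l \<and> cycle_edges l' = cycle_edges l \<and>
      {last l', hd l'} = {p, q}"
  proof (cases "{p, q} = {last l, hd l}")
    case False
    then have "{p, q} \<in> path_edges l" using assms by (simp add: cycle_edges_conv)
    then obtain a b where "l = a @ b" "a \<noteq> []" "b \<noteq> []" "{p, q} = {last a, hd b}"
      by (rule path_edges_elim)
    then show ?thesis
      by (intro exI[of _ "b @ a"]) (auto simp: cycle_edges_append_commute)
  qed (use assms in auto)
  then obtain l' where l': "l' \<noteq> []" "set l' = set l" "distinct l' = distinct l"
    "cycle_edges l' = cycle_edges l" "{last l', hd l'} = {p, q}" by blast
  then consider (forward) "hd l' = p" "last l' = q" | (backward) "hd l' = q" "last l' = p"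
    by (auto simp: doubleton_eq_iff)
  then show thesis
  proof cases
    case forward
    then show ?thesis using that l' by blast
  next
    case backward
    then show ?thesis using that[of "rev l'"] l' by (simp add: cycle_edges_rev hd_rev last_rev)
  qed
qed

locale gluable_paths =
  fixes E :: "'v set set" and path :: "'t \<Rightarrow> 'v list" and owner :: "'e \<Rightarrow> 't"
    and lower upper :: "'e \<Rightarrow> 'v" and feeds :: "'e \<Rightarrow> 'e \<Rightarrow> bool"
  assumes path_nonempty: "path t \<noteq> []"
    and distinct_path: "distinct (path t)"
    and cycle_edges_path: "cycle_edges (path t) \<subseteq> E"
    and disjoint_paths: "t \<noteq> t' \<Longrightarrow> set (path t) \<inter> set (path t') = {}"
    and ends_path: "{lower e, upper e} \<in> path_edges (path (owner e))"
    and ends_inject: "{lower e, upper e} = {lower f, upper f} \<Longrightarrow> e = f"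
    and feeds_edge: "feeds e f \<Longrightarrow> {upper e, lower f} \<in> E"
begin

definition spanning_cycle :: "'t set \<Rightarrow> 'e set \<Rightarrow> 'v list \<Rightarrow> bool" where
  "spanning_cycle X A l \<longleftrightarrow> l \<noteq> [] \<and> distinct l \<and> set l = (\<Union>t\<in>X. set (path t)) \<and>
     cycle_edges l \<subseteq> E \<and> (\<forall>e\<in>A. {lower e, upper e} \<in> cycle_edges l)"

definition spanning_path :: "'t set \<Rightarrow> 'e set \<Rightarrow> 'v list \<Rightarrow> bool" where
  "spanning_path X A l \<longleftrightarrow> l \<noteq> [] \<and> distinct l \<and> set l = (\<Union>t\<in>X. set (path t)) \<and>
     path_edges l \<subseteq> E \<and> (\<forall>e\<in>A. {lower e, upper e} \<in> path_edges l)"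

lemma spanning_cycle_path: "A \<subseteq> owner -` {t} \<Longrightarrow> spanning_cycle {t} A (path t)"
  using path_nonempty distinct_path cycle_edges_path ends_path
  by (auto simp: spanning_cycle_def cycle_edges_conv)

lemma spanning_cycle_open:
  assumes "spanning_cycle X (insert e A) l" "e \<notin> A"
  obtains l' where "spanning_path X A l'" "hd l' = lower e" "last l' = upper e"
proof -
  have "{lower e, upper e} \<in> cycle_edges l" "l \<noteq> []"
    using assms(1) by (simp_all add: spanning_cycle_def)
  then obtain l' where l': "l' \<noteq> []" "set l' = set l" "distinct l' = distinct l"
    "cycle_edges l' = cycle_edges l" "hd l' = lower e" "last l' = upper e"
    by (rule cycle_edges_rotate)
  have cycle: "cycle_edges l = insert {lower e, upper e} (path_edges l')"
    using l' by (metis cycle_edges_conv insert_commute)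
  have "{lower f, upper f} \<in> path_edges l'" if "f \<in> A" for f
  proof -
    have "{lower f, upper f} \<in> cycle_edges l"
      using assms(1) that by (simp add: spanning_cycle_def)
    moreover have "{lower f, upper f} \<noteq> {lower e, upper e}"
      using ends_inject that assms(2) by metis
    ultimately show ?thesis unfolding cycle by blast
  qed
  then have "spanning_path X A l'"
    using assms(1) l'(1-3) cycle by (simp add: spanning_path_def spanning_cycle_def)
  from that[OF this l'(5,6)] show thesis .
qed

lemma spanning_path_append:
  assumes l: "spanning_path X A l" and l': "spanning_path X' A' l'"
    and "X \<inter> X' = {}" "{last l, hd l'} \<in> E"
  shows "spanning_path (X \<union> X') (A \<union> A') (l @ l')"
proof -
  have "set (path t) \<inter> set (path t') = {}" if "t \<in> X" "t' \<in> X'" for t t'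
    using that assms(3) by (intro disjoint_paths) auto
  then have "set l \<inter> set l' = {}"
    using l l' by (auto simp: spanning_path_def)
  then show ?thesis
    using l l' assms(4) unfolding spanning_path_def by (auto simp: path_edges_append)
qed

lemma spanning_cycle_of_glued:
  "glued owner feeds X A \<Longrightarrow> \<exists>l. spanning_cycle X A l"
  "glued_path owner feeds X A e f \<Longrightarrow> \<exists>l. spanning_path X A l \<and> hd l = lower e \<and> last l = upper f"
proof (induction rule: glued_glued_path.inducts)
  case (glued_single A t)
  then show ?case using spanning_cycle_path by blast
next
  case (glued_path_open X e A)
  then show ?case using spanning_cycle_open by metis
next
  case (glued_path_join X A e f X' A' e' f')
  then obtain l l' where l: "spanning_path X A l" "hd l = lower e" "last l = upper f"
    and l': "spanning_path X' A' l'" "hd l' = lower e'" "last l' = upper f'" by blast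
  then have "spanning_path (X \<union> X') (A \<union> A') (l @ l')"
    using glued_path_join feeds_edge[of f e'] by (intro spanning_path_append) simp_all
  moreover have "hd (l @ l') = lower e" "last (l @ l') = upper f'"
    using l l' by (auto simp: spanning_path_def)
  ultimately show ?case by blast
next
  case (glued_close X A e f)
  then obtain l where "spanning_path X A l" "hd l = lower e" "last l = upper f" by blast
  then have "spanning_cycle X A l"
    using glued_close feeds_edge[of f e]
    by (auto simp: spanning_path_def spanning_cycle_def cycle_edges_conv)
  then show ?case ..
qed

end

section \<open>Dyck words\<close>

definition rev_compl :: "bool list \<Rightarrow> bool list" where
  "rev_compl y = rev (map Not y)"

lemma map_Not_map_Not [simp]: "map Not (map Not y) = y"
  by (simp add: comp_def)

lemma rev_compl_simps [simp]:
  "rev_compl [] = []" "rev_compl (x # y) = rev_compl y @ [\<not> x]"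
  "rev_compl (y @ z) = rev_compl z @ rev_compl y" "length (rev_compl y) = length y"
  "rev_compl (map Not y) = rev y" "rev_compl (rev y) = map Not y"
  by (simp_all add: rev_compl_def rev_map comp_def)

lemma rev_compl_rev_compl [simp]: "rev_compl (rev_compl y) = y"
  and map_Not_rev_compl [simp]: "map Not (rev_compl y) = rev y"
  by (simp_all add: rev_compl_def rev_map comp_def)

lemma rev_compl_inject [simp]: "rev_compl y = rev_compl z \<longleftrightarrow> y = z"
  by (metis rev_compl_rev_compl)

definition height :: "bool list \<Rightarrow> int" where
  "height y = (\<Sum>x\<leftarrow>y. if x then 1 else - 1)"

lemma height_Nil [simp]: "height [] = 0"
  and height_Cons [simp]: "height (x # y) = (if x then 1 else - 1) + height y"
  and height_append [simp]: "height (y @ z) = height y + height z"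
  by (simp_all add: height_def)

lemma height_map_Not [simp]: "height (map Not y) = - height y"
  by (induction y) auto

lemma height_rev [simp]: "height (rev y) = height y"
  by (induction y) auto

lemma height_rev_compl [simp]: "height (rev_compl y) = - height y"
  by (simp add: rev_compl_def)

definition dyck :: "bool list \<Rightarrow> bool" where
  "dyck y \<longleftrightarrow> height y = 0 \<and> (\<forall>n. 0 \<le> height (take n y))"

lemma dyck_Nil [simp]: "dyck []"
  by (simp add: dyck_def)

lemma height_dyck: "dyck y \<Longrightarrow> height y = 0"
  by (simp add: dyck_def)

lemma height_dyck_prefix: "dyck (p @ q) \<Longrightarrow> 0 \<le> height p"
  unfolding dyck_def by (metis append_eq_conv_conj)

lemma dyck_rev_compl:
  assumes y: "dyck y"
  shows "dyck (rev_compl y)"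
proof -
  have "0 \<le> height (take n (rev_compl y))" for n
  proof -
    let ?m = "length y - n"
    have "height (take ?m y) + height (drop ?m y) = 0"
      using y by (metis append_take_drop_id height_dyck height_append)
    moreover have "0 \<le> height (take ?m y)"
      using y by (simp add: dyck_def)
    moreover have "take n (rev_compl y) = rev_compl (drop ?m y)"
      by (simp add: rev_compl_def take_rev drop_map)
    ultimately show ?thesis by simp
  qed
  then show ?thesis
    using y by (simp add: dyck_def)
qed

lemma dyck_Cons_append:
  assumes "dyck y" "dyck z"
  shows "dyck (True # y @ False # z)"
  using assms by (auto simp: dyck_def take_Cons' take_append)

text \<open>The prefix ends just before the word first reaches height \<open>-1\<close>.\<close>
lemma first_descent:
  assumes "height (take n r) < 0"
  obtains a b where "r = a @ False # b" "dyck a"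
proof -
  obtain m where m: "height (take m r) < 0" "\<And>i. i < m \<Longrightarrow> 0 \<le> height (take i r)"
    using exists_least_iff[of "\<lambda>m. height (take m r) < 0"] assms by (auto simp: not_less)
  then obtain i where i: "m = Suc i" by (cases m) auto
  have "i < length r"
    using m[unfolded i] by (metis lessI linorder_not_less take_all le_SucI)
  then have split: "r = take i r @ r ! i # drop (Suc i) r" "take m r = take i r @ [r ! i]"
    by (simp_all add: i id_take_nth_drop take_Suc_conv_app_nth)
  have "0 \<le> height (take i r)" using m(2) i by simp
  with m(1) have "\<not> r ! i" "height (take i r) = 0"
    unfolding split(2) by (auto split: if_splits)
  moreover have "0 \<le> height (take k (take i r))" for k
    using m(2) i by (simp add: min_def)
  ultimately show thesis
    using that[of "take i r" "drop (Suc i) r"] split(1) by (simp add: dyck_def)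
qed

lemma dyck_append_False_inject:
  assumes "dyck a" "dyck a'"
  shows "a @ False # b = a' @ False # b' \<longleftrightarrow> a = a' \<and> b = b'"
proof -
  have not_longer: "r = []" if "dyck (a @ r)" "dyck a" "a @ r @ False # b = a @ False # b'" for a r b b'
  proof (cases r)
    case (Cons x s)
    then have "dyck ((a @ [False]) @ s)" using that by simp
    then show ?thesis using height_dyck_prefix height_dyck[OF that(2)] by fastforce
  qed
  have "a = a' \<and> b = b'" if eq: "a @ False # b = a' @ False # b'"
  proof -
    from eq consider (longer) r where "a = a' @ r" | (shorter) r where "a' = a @ r"
      by (metis append_eq_append_conv2)
    then show ?thesis
    proof cases
      case longer
      then have "r = []" using not_longer[of a' r b b'] assms eq by simp
      then show ?thesis using longer eq by simp
    next
      case shorter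
      then have "r = []" using not_longer[of a r b' b] assms eq by simp
      then show ?thesis using shorter eq by simp
    qed
  qed
  then show ?thesis by blast
qed

section \<open>Partition of two levels of the hypercube into paths\<close>

datatype btree = Leaf | Node btree btree

definition trees :: "nat \<Rightarrow> btree set" where
  "trees m = {t. size t = m}"

lemma mem_trees_iff [simp]: "t \<in> trees m \<longleftrightarrow> size t = m"
  by (simp add: trees_def)

text \<open>The left subtree is stored reversed and complemented, because the path of a tree traverses its
  left subtree backwards.\<close>
fun word :: "btree \<Rightarrow> bool list" where
  "word Leaf = []"
| "word (Node w v) = True # rev_compl (word w) @ False # word v"

fun path :: "btree \<Rightarrow> bool list list" where
  "path Leaf = [[]]"
| "path (Node w v) = word (Node w v) #
     map (\<lambda>y. True # rev_compl y @ True # word v) (path w) @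
     map (\<lambda>y. False # rev (word w) @ True # y) (path v)"

lemma length_word [simp]: "length (word t) = 2 * size t"
  by (induction t) auto

lemma dyck_word [simp]: "dyck (word t)"
  by (induction t) (auto intro: dyck_Cons_append dyck_rev_compl)

lemma height_word [simp]: "height (word t) = 0"
  by (simp add: height_dyck)

lemma word_inject [simp]: "word t = word t' \<longleftrightarrow> t = t'"
proof
  show "word t = word t' \<Longrightarrow> t = t'"
  proof (induction t arbitrary: t')
    case Leaf
    then show ?case by (cases t') auto
  next
    case (Node w v)
    then obtain w' v' where t': "t' = Node w' v'" by (cases t') auto
    with Node.prems have "rev_compl (word w) @ False # word v = rev_compl (word w') @ False # word v'"
      by simp
    then have "word w = word w'" "word v = word v'"
      using dyck_append_False_inject dyck_rev_compl by simp_all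
    then show ?case using Node.IH t' by blast
  qed
qed simp

lemma word_surj: "dyck y \<Longrightarrow> \<exists>t. word t = y"
proof (induction y rule: measure_induct_rule[where f = length])
  case (less y)
  show ?case
  proof (cases y)
    case Nil
    then show ?thesis by (intro exI[of _ Leaf]) simp
  next
    case (Cons x r)
    have x: "x"
      using height_dyck_prefix[of "[x]" r] less.prems Cons by (auto split: if_splits)
    then have "height (take (length r) r) < 0"
      using height_dyck[OF less.prems] Cons by simp
    then obtain a b where r: "r = a @ False # b" and a: "dyck a"
      by (rule first_descent)
    have "0 \<le> height (take n b)" for n
    proof -
      have "0 \<le> height (True # a @ False # take n b)"
        using less.prems Cons x r by (intro height_dyck_prefix[of _ "drop n b"]) simp
      then show ?thesis using height_dyck[OF a] by simp
    qed
    then have "dyck b"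
      using height_dyck[OF less.prems] height_dyck[OF a] Cons x r by (simp add: dyck_def)
    moreover have "dyck (rev_compl a)"
      using a by (rule dyck_rev_compl)
    moreover have "length b < length y" "length (rev_compl a) < length y"
      using Cons r by simp_all
    ultimately obtain w v where "word w = rev_compl a" "word v = b"
      using less.IH by metis
    then have "word (Node w v) = y"
      using Cons r x by simp
    then show ?thesis ..
  qed
qed

lemma rev_compl_word_append_False_inject [simp]:
  "rev_compl (word w) @ False # y = rev_compl (word w') @ False # y' \<longleftrightarrow> w = w' \<and> y = y'"
  by (simp add: dyck_append_False_inject dyck_rev_compl)

lemma rev_word_append_True_inject [simp]:
  "rev (word w) @ True # y = rev (word w') @ True # y' \<longleftrightarrow> w = w' \<and> y = y'"
proof -
  have "rev (word w) @ True # y = rev (word w') @ True # y' \<longleftrightarrow>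
      map Not (rev (word w) @ True # y) = map Not (rev (word w') @ True # y')"
    by (metis map_Not_map_Not)
  also have "\<dots> \<longleftrightarrow> rev_compl (word w) @ False # map Not y = rev_compl (word w') @ False # map Not y'"
    by (simp add: rev_compl_def rev_map)
  also have "\<dots> \<longleftrightarrow> w = w' \<and> y = y'"
    unfolding rev_compl_word_append_False_inject by (metis map_Not_map_Not)
  finally show ?thesis .
qed

lemma append_True_word_inject [simp]:
  "y @ True # word v = y' @ True # word v' \<longleftrightarrow> y = y' \<and> v = v'"
  using rev_word_append_True_inject[of v "rev y" v' "rev y'"]
  by (subst rev_is_rev_conv[symmetric]) auto

lemma left_word_neq_word [simp]:
  "rev_compl y @ True # word u \<noteq> rev_compl (word w) @ False # word v"
proof
  assume "rev_compl y @ True # word u = rev_compl (word w) @ False # word v"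
  then have eq: "(True # rev_compl y) @ True # word u = word (Node w v)" by simp
  then have "height ((True # rev_compl y) @ True # word u) = 0"
    by (metis height_word)
  then have "height (True # rev_compl y) < 0" by simp
  moreover have "0 \<le> height (True # rev_compl y)"
    using eq by (metis dyck_word height_dyck_prefix)
  ultimately show False by simp
qed

lemmas word_neq_left_word [simp] = left_word_neq_word[symmetric]

lemma path_nonempty [simp]: "path t \<noteq> []"
  by (cases t) auto

lemma hd_path [simp]: "hd (path t) = word t"
  by (cases t) auto

lemma last_path [simp]: "last (path t) = map Not (word t)"
  by (induction t) (auto simp: last_map)

lemma length_path: "length (path t) = 2 * size t + 1"
  by (induction t) auto

lemma height_mem_path: "y \<in> set (path t) \<Longrightarrow> height y \<in> {0, 2}"
  by (induction t arbitrary: y) fastforce+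

lemma length_mem_path: "y \<in> set (path t) \<Longrightarrow> length y = 2 * size t"
  by (induction t arbitrary: y) auto

lemma distinct_path: "distinct (path t)"
  by (induction t) (auto simp: distinct_map inj_on_def)

lemma mem_path_unique: "y \<in> set (path t) \<Longrightarrow> y \<in> set (path t') \<Longrightarrow> t = t'"
proof (induction t arbitrary: y t')
  case Leaf
  then show ?case using length_mem_path[of y t'] by (cases t') auto
next
  case (Node w v)
  then obtain w' v' where t': "t' = Node w' v'"
    using length_mem_path[of y] by (cases t') fastforce+
  show ?case
    using Node.prems unfolding t' by (auto dest: Node.IH)
qed

lemma first_ascent:
  assumes "0 < height (take n r)"
  obtains w b where "r = rev (word w) @ True # b"
proof -
  have "height (take n (map Not r)) < 0"
    using assms by (simp add: take_map)
  then obtain a b where r: "map Not r = a @ False # b" and "dyck a"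
    by (rule first_descent)
  then obtain w where w: "word w = rev_compl a"
    using word_surj dyck_rev_compl by blast
  have "r = map Not (a @ False # b)"
    using r by (metis map_Not_map_Not)
  also have "\<dots> = rev (word w) @ True # map Not b"
    by (simp add: w rev_compl_def)
  finally show thesis by (rule that)
qed

lemma height_pos_take_rev:
  assumes "height (True # r) \<in> {0, 2}" "\<not> dyck (True # r)"
  obtains n where "0 < height (take n (rev r))"
proof (cases "height (True # r) = 2")
  case True
  then show thesis using that[of "length r"] by simp
next
  case False
  then have r: "height r = - 1" using assms(1) by simp
  then obtain n where "height (take n (True # r)) < 0"
    using assms(2) by (auto simp: dyck_def not_le)
  then have "height (take (n - 1) r) < - 1"
    by (cases n) auto
  then obtain m where "height (take m r) < - 1" ..
  moreover have "height (take m r) + height (drop m r) = height r"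
    by (metis append_take_drop_id height_append)
  ultimately have "0 < height (rev (drop m r))"
    using r by simp
  also have "rev (drop m r) = take (length r - m) (rev r)"
    by (simp add: rev_drop)
  finally show thesis by (rule that)
qed

lemma mem_path_surj: "height y \<in> {0, 2} \<Longrightarrow> \<exists>t. y \<in> set (path t)"
proof (induction y rule: measure_induct_rule[where f = length])
  case (less y)
  consider (dyck) "dyck y" | (down) r where "y = False # r" | (up) r where "y = True # r" "\<not> dyck y"
    by (metis (full_types) dyck_Nil neq_Nil_conv)
  then show ?case
  proof cases
    case dyck
    then obtain t where "word t = y" using word_surj by blast
    then have "y \<in> set (path t)" by (metis hd_in_set hd_path path_nonempty)
    then show ?thesis ..
  next
    case down
    then have "0 < height (take (length r) r)" using less.prems by auto
    then obtain w b where r: "r = rev (word w) @ True # b" by (rule first_ascent)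
    then obtain v where "b \<in> set (path v)"
      using less.IH[of b] less.prems down by auto
    then have "y \<in> set (path (Node w v))" using down r by simp
    then show ?thesis ..
  next
    case up
    then obtain n where "0 < height (take n (rev r))"
      using less.prems height_pos_take_rev by metis
    then obtain v b where "rev r = rev (word v) @ True # b" by (rule first_ascent)
    then have r: "r = rev b @ True # word v" by (simp add: rev_swap)
    then obtain w where "map Not b \<in> set (path w)"
      using less.IH[of "map Not b"] less.prems up by auto
    then have "y \<in> (\<lambda>z. True # rev_compl z @ True # word v) ` set (path w)"
      using up r by (intro rev_image_eqI[of "map Not b"]) simp_all
    then have "y \<in> set (path (Node w v))" by simp
    then show ?thesis ..
  qed
qed

inductive covered :: "bool list \<Rightarrow> bool list \<Rightarrow> bool" (infix "\<prec>" 50) where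
  "p @ False # q \<prec> p @ True # q"

lemma covered_Cons [simp]:
  "x # y \<prec> x' # z \<longleftrightarrow> x = x' \<and> y \<prec> z \<or> \<not> x \<and> x' \<and> y = z"
proof
  assume "x # y \<prec> x' # z"
  then obtain p q where pq: "x # y = p @ False # q" "x' # z = p @ True # q"
    by cases
  then show "x = x' \<and> y \<prec> z \<or> \<not> x \<and> x' \<and> y = z"
    by (cases p) (auto intro: covered.intros)
next
  assume "x = x' \<and> y \<prec> z \<or> \<not> x \<and> x' \<and> y = z"
  then show "x # y \<prec> x' # z"
  proof
    assume "x = x' \<and> y \<prec> z"
    then show ?thesis using covered.intros[of "x # p" q for p q] by (auto elim!: covered.cases)
  next
    assume "\<not> x \<and> x' \<and> y = z"
    then show ?thesis using covered.intros[of "[]" z] by simp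
  qed
qed

lemma covered_append_left [simp]: "p @ y \<prec> p @ z \<longleftrightarrow> y \<prec> z"
  by (induction p) auto

lemma covered_rev: "y \<prec> z \<Longrightarrow> rev y \<prec> rev z"
  using covered.intros[of "rev q" "rev p" for p q] by (auto elim!: covered.cases)

lemma covered_append_right: "y \<prec> z \<Longrightarrow> y @ q \<prec> z @ q"
  using covered_rev[of "rev y" "rev z"] by (auto elim!: covered.cases)

lemma covered_map_Not: "y \<prec> z \<Longrightarrow> map Not z \<prec> map Not y"
  by (auto elim!: covered.cases)

lemma covered_rev_compl: "y \<prec> z \<Longrightarrow> rev_compl z \<prec> rev_compl y"
  unfolding rev_compl_def by (intro covered_rev covered_map_Not)

text \<open>
  The path of \<open>Node w v\<close> consists of the edge \<open>Rise w v\<close>, the copies \<open>InL e v\<close> of the edges of the path of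
  \<open>w\<close>, the edge \<open>Cross w v\<close>, and the copies \<open>InR w e\<close> of the edges of the path of \<open>v\<close>.
\<close>
datatype edge = Rise btree btree | Cross btree btree | InL edge btree | InR btree edge

primrec edge_tree :: "edge \<Rightarrow> btree" where
  "edge_tree (Rise w v) = Node w v"
| "edge_tree (Cross w v) = Node w v"
| "edge_tree (InL e v) = Node (edge_tree e) v"
| "edge_tree (InR w e) = Node w (edge_tree e)"

fun lower upper :: "edge \<Rightarrow> bool list" where
  "lower (Rise w v) = word (Node w v)"
| "upper (Rise w v) = True # rev_compl (word w) @ True # word v"
| "lower (Cross w v) = False # rev (word w) @ True # word v"
| "upper (Cross w v) = True # rev (word w) @ True # word v"
| "lower (InL e v) = True # rev_compl (upper e) @ True # word v"
| "upper (InL e v) = True # rev_compl (lower e) @ True # word v"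
| "lower (InR w e) = False # rev (word w) @ True # lower e"
| "upper (InR w e) = False # rev (word w) @ True # upper e"

lemma vimage_edge_tree_Node: "edge_tree -` {Node w v} =
    {Rise w v, Cross w v} \<union> (\<lambda>e. InL e v) ` (edge_tree -` {w}) \<union> InR w ` (edge_tree -` {v})"
proof -
  have "edge_tree e = Node w v \<longleftrightarrow> e \<in> {Rise w v, Cross w v} \<union>
      (\<lambda>e. InL e v) ` (edge_tree -` {w}) \<union> InR w ` (edge_tree -` {v})" for e
    by (cases e) auto
  then show ?thesis by auto
qed

lemma lower_covered_upper: "lower e \<prec> upper e"
  by (induction e) (auto intro: covered_append_right covered_rev_compl)

lemma height_lower_upper: "height (lower e) = 0" "height (upper e) = 2"
  by (induction e) auto

lemma lower_upper_inject: "lower e = lower f \<Longrightarrow> upper e = upper f \<Longrightarrow> e = f"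
  by (induction e arbitrary: f; case_tac f) auto

lemma ends_inject:
  assumes "{lower e, upper e} = {lower f, upper f}"
  shows "e = f"
proof -
  have "lower e \<noteq> upper f" "upper e \<noteq> lower f"
    using height_lower_upper by (metis zero_neq_numeral)+
  then show ?thesis
    using assms by (auto simp: doubleton_eq_iff intro: lower_upper_inject)
qed

lemma path_edges_path:
  "path_edges (path t) = (\<lambda>e. {lower e, upper e}) ` (edge_tree -` {t})"
proof (induction t)
  case Leaf
  have "edge_tree e \<noteq> Leaf" for e by (cases e) auto
  then show ?case by (auto simp: vimage_def)
next
  case (Node w v)
  then show ?case
    by (simp add: path_edges_Cons path_edges_append path_edges_map hd_append hd_map last_map
        vimage_edge_tree_Node image_Un image_image insert_commute Un_assoc)
qed

definition word_edges :: "bool list set set" where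
  "word_edges = {{y, z} | y z. y \<prec> z \<or> z = map Not y}"

definition feeds :: "edge \<Rightarrow> edge \<Rightarrow> bool" where
  "feeds e f \<longleftrightarrow> lower f \<prec> upper e"

interpretation tree_paths: gluable_paths word_edges path edge_tree lower upper feeds
proof
  show "cycle_edges (path t) \<subseteq> word_edges" for t
    using lower_covered_upper
    by (auto simp: cycle_edges_conv path_edges_path word_edges_def)
  show "set (path t) \<inter> set (path t') = {}" if "t \<noteq> t'" for t t'
    using that mem_path_unique by blast
  show "{upper e, lower f} \<in> word_edges" if "feeds e f" for e f
    using that by (auto simp: feeds_def word_edges_def)
qed (auto simp: distinct_path path_edges_path intro: ends_inject)

abbreviation linked :: "btree set \<Rightarrow> edge set \<Rightarrow> bool" where
  "linked \<equiv> glued edge_tree feeds"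

section \<open>From words to the odd graph\<close>

definition middle_words :: "nat \<Rightarrow> bool list set" where
  "middle_words k = {y. length y = 2 * k \<and> height y \<in> {0, 2}}"

lemma UN_path_trees: "(\<Union>t\<in>trees k. set (path t)) = middle_words k"
proof
  show "(\<Union>t\<in>trees k. set (path t)) \<subseteq> middle_words k"
    using height_mem_path length_mem_path by (auto simp: middle_words_def)
  show "middle_words k \<subseteq> (\<Union>t\<in>trees k. set (path t))"
  proof
    fix y assume y: "y \<in> middle_words k"
    then obtain t where t: "y \<in> set (path t)"
      using mem_path_surj by (auto simp: middle_words_def)
    then have "t \<in> trees k"
      using y length_mem_path[OF t] by (simp add: middle_words_def)
    with t show "y \<in> (\<Union>t\<in>trees k. set (path t))" by blast
  qed
qed

definition ones :: "bool list \<Rightarrow> nat set" where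
  "ones y = Suc ` {i. i < length y \<and> y ! i}"

definition vertex_of_word :: "nat \<Rightarrow> bool list \<Rightarrow> nat set" where
  "vertex_of_word k y = (if height y = 0 then ones y else {1..2 * k + 1} - ones y)"

definition word_of_vertex :: "nat \<Rightarrow> nat set \<Rightarrow> bool list" where
  "word_of_vertex k A = map (\<lambda>i. Suc i \<in> A \<longleftrightarrow> 2 * k + 1 \<notin> A) [0..<2 * k]"

lemma ones_subset: "ones y \<subseteq> {1..length y}"
  by (auto simp: ones_def)

lemma Suc_mem_ones [simp]: "Suc i \<in> ones y \<longleftrightarrow> i < length y \<and> y ! i"
  by (auto simp: ones_def)

lemma card_ones: "2 * int (card (ones y)) = int (length y) + height y"
proof -
  have "card (ones y) = length (filter id y)"
    unfolding ones_def by (subst card_image) (simp_all add: length_filter_conv_card)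
  moreover have "2 * int (length (filter id y)) = int (length y) + height y"
    by (induction y) auto
  ultimately show ?thesis by simp
qed

lemma ones_mono: "y \<prec> z \<Longrightarrow> ones y \<subseteq> ones z"
  by (auto simp: ones_def nth_append nth_Cons split: nat.splits if_splits elim!: covered.cases)

lemma pverts_odd_graph: "pverts (odd_graph k) = {A. A \<subseteq> {1..2 * k + 1} \<and> card A = k}"
  by (simp add: odd_graph_def kneser_graph_def)

lemma parcs_odd_graph_iff: "(A, B) \<in> parcs (odd_graph k) \<longleftrightarrow>
    A \<in> pverts (odd_graph k) \<and> B \<in> pverts (odd_graph k) \<and> A \<inter> B = {}"
  by (auto simp: odd_graph_def kneser_graph_def)

lemma ones_word_of_vertex:
  assumes "A \<subseteq> {1..2 * k + 1}"
  shows "ones (word_of_vertex k A) = (if 2 * k + 1 \<in> A then {1..2 * k + 1} - A else A)"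
    (is "_ = ?B")
proof -
  have "j \<in> ones (word_of_vertex k A) \<longleftrightarrow> j \<in> ?B" for j
  proof (cases j)
    case (Suc i)
    then show ?thesis
      using assms by (cases "i < 2 * k") (auto simp: word_of_vertex_def dest: subsetD)
  qed (use assms in \<open>auto simp: ones_def\<close>)
  then show ?thesis by blast
qed

lemma word_of_vertex_mem_middle_words:
  assumes "A \<in> pverts (odd_graph k)"
  shows "word_of_vertex k A \<in> middle_words k"
    and "height (word_of_vertex k A) = (if 2 * k + 1 \<in> A then 2 else 0)"
proof -
  have A: "A \<subseteq> {1..2 * k + 1}" "card A = k"
    using assms by (simp_all add: pverts_odd_graph)
  then have "card ({1..2 * k + 1} - A) = k + 1"
    using finite_subset[OF A(1)] by (simp add: card_Diff_subset)
  moreover have length: "length (word_of_vertex k A) = 2 * k"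
    by (simp add: word_of_vertex_def)
  ultimately show "height (word_of_vertex k A) = (if 2 * k + 1 \<in> A then 2 else 0)"
    using card_ones[of "word_of_vertex k A"] A
    by (cases "2 * k + 1 \<in> A") (simp_all add: ones_word_of_vertex)
  then show "word_of_vertex k A \<in> middle_words k"
    using length by (simp add: middle_words_def)
qed

lemma vertex_of_word_of_vertex:
  assumes "A \<in> pverts (odd_graph k)"
  shows "vertex_of_word k (word_of_vertex k A) = A"
proof -
  have "A \<subseteq> {1..2 * k + 1}" using assms by (simp add: pverts_odd_graph)
  then show ?thesis
    using word_of_vertex_mem_middle_words(2)[OF assms]
    by (simp add: vertex_of_word_def ones_word_of_vertex double_diff)
qed

lemma word_of_vertex_of_word:
  assumes "y \<in> middle_words k"
  shows "word_of_vertex k (vertex_of_word k y) = y"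
proof (rule nth_equalityI)
  have y: "length y = 2 * k" using assms by (simp add: middle_words_def)
  then show "length (word_of_vertex k (vertex_of_word k y)) = length y"
    by (simp add: word_of_vertex_def)
  show "word_of_vertex k (vertex_of_word k y) ! i = y ! i"
    if "i < length (word_of_vertex k (vertex_of_word k y))" for i
    using that y by (simp add: word_of_vertex_def vertex_of_word_def)
qed

lemma vertex_of_word_mem_pverts:
  assumes "y \<in> middle_words k"
  shows "vertex_of_word k y \<in> pverts (odd_graph k)"
proof -
  have y: "length y = 2 * k" "height y \<in> {0, 2}"
    using assms by (simp_all add: middle_words_def)
  then have sub: "ones y \<subseteq> {1..2 * k + 1}"
    using ones_subset[of y] by auto
  moreover have "card (ones y) = (if height y = 0 then k else k + 1)"
    using card_ones[of y] y by auto
  ultimately show ?thesis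
    using finite_subset[OF sub]
    by (simp add: vertex_of_word_def pverts_odd_graph card_Diff_subset)
qed

lemma bij_betw_vertex_of_word:
  "bij_betw (vertex_of_word k) (middle_words k) (pverts (odd_graph k))"
  by (rule bij_betw_byWitness[where f' = "word_of_vertex k"])
    (auto simp: vertex_of_word_of_vertex word_of_vertex_of_word
      vertex_of_word_mem_pverts word_of_vertex_mem_middle_words)

lemma vertex_of_word_disjoint:
  assumes "{y, z} \<in> word_edges" "y \<in> middle_words k" "z \<in> middle_words k"
  shows "vertex_of_word k y \<inter> vertex_of_word k z = {}"
proof -
  have covered: "vertex_of_word k y \<inter> vertex_of_word k z = {}"
    if "y \<prec> z" "y \<in> middle_words k" "z \<in> middle_words k" for y z
  proof -
    have "height z = height y + 2" using that(1) by (auto elim!: covered.cases)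
    then have "height y = 0" "height z \<noteq> 0" using that by (auto simp: middle_words_def)
    then show ?thesis using ones_mono[OF that(1)] by (auto simp: vertex_of_word_def)
  qed
  have complement: "vertex_of_word k y \<inter> vertex_of_word k (map Not y) = {}"
    if "y \<in> middle_words k" "map Not y \<in> middle_words k" for y
    using that by (auto simp: middle_words_def vertex_of_word_def ones_def)
  from assms(1) consider "y \<prec> z" | "z \<prec> y" | "z = map Not y" | "y = map Not z"
    by (auto simp: word_edges_def doubleton_eq_iff)
  then show ?thesis
    using covered[of y z] covered[of z y] complement[of y] complement[of z] assms(2,3)
    by cases (simp_all add: Int_commute)
qed

lemma parcs_odd_graph_of_word_edge:
  assumes "s \<in> word_edges" "s \<subseteq> middle_words k" "{a, b} = vertex_of_word k ` s"
  shows "(a, b) \<in> parcs (odd_graph k)"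
proof -
  obtain y z where s: "s = {y, z}"
    using assms(1) by (auto simp: word_edges_def)
  then have yz: "y \<in> middle_words k" "z \<in> middle_words k"
    using assms(2) by auto
  have "{a, b} = {vertex_of_word k y, vertex_of_word k z}"
    using assms(3) s by simp
  moreover have "vertex_of_word k y \<inter> vertex_of_word k z = {}"
    using assms(1) s yz by (intro vertex_of_word_disjoint) simp_all
  ultimately show ?thesis
    using yz[THEN vertex_of_word_mem_pverts]
    by (auto simp: parcs_odd_graph_iff doubleton_eq_iff)
qed

lemma pcas_vwalk_arcs: "l \<noteq> [] \<Longrightarrow> pcas (hd l) (vwalk_arcs l) (last l)"
  by (induction l rule: vwalk_arcs.induct) auto

lemma pawalk_verts_vwalk_arcs: "l \<noteq> [] \<Longrightarrow> pawalk_verts (hd l) (vwalk_arcs l) = l"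
  by (induction l rule: vwalk_arcs.induct) auto

lemma fst_vwalk_arcs_snoc: "fst ` set (vwalk_arcs (l @ [x])) = set l"
  by (induction l rule: vwalk_arcs.induct) auto

lemma hamilton_cycle_vwalk_arcs:
  assumes l: "distinct l" "3 \<le> length l" "set l = pverts G"
    and adjacent: "\<And>a b. {a, b} \<in> cycle_edges l \<Longrightarrow> (a, b) \<in> parcs G"
  shows "pre_digraph.hamilton_cycle (with_proj G) (vwalk_arcs (l @ [hd l]))"
proof -
  let ?l = "l @ [hd l]"
  have "l \<noteq> []" using l(2) by auto
  have "set (vwalk_arcs ?l) \<subseteq> parcs G"
    using adjacent by (force simp: cycle_edges_def path_edges_def)
  moreover have "pcas (hd l) (vwalk_arcs ?l) (hd l)"
    using pcas_vwalk_arcs[of ?l] \<open>l \<noteq> []\<close> by simp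
  moreover have "hd l \<in> pverts G"
    using hd_in_set[OF \<open>l \<noteq> []\<close>] l(3) by simp
  moreover have "distinct (tl (pawalk_verts (hd l) (vwalk_arcs ?l)))"
    using pawalk_verts_vwalk_arcs[of ?l] l(1) \<open>l \<noteq> []\<close> by (cases l) auto
  moreover have "3 \<le> length (vwalk_arcs ?l)"
    using l(2) vwalk_length_simp[of ?l] unfolding vwalk_length_def by simp
  ultimately show ?thesis
    using l(3) fst_vwalk_arcs_snoc[of l "hd l"]
    by (auto simp: pre_digraph.hamilton_cycle_def pre_digraph.cycle_def pre_digraph.awalk_def
        cas_with_proj_eq awalk_verts_with_proj_eq)
qed

lemma hamilton_cycle_of_linked:
  assumes "linked (trees k) A" "k \<ge> 1"
  shows "\<exists>p. pre_digraph.hamilton_cycle (with_proj (odd_graph k)) p"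
proof -
  obtain l where "tree_paths.spanning_cycle (trees k) A l"
    using tree_paths.spanning_cycle_of_glued(1)[OF assms(1)] by blast
  then have l: "l \<noteq> []" "distinct l" "set l = middle_words k" "cycle_edges l \<subseteq> word_edges"
    by (simp_all add: tree_paths.spanning_cycle_def UN_path_trees)
  let ?l = "map (vertex_of_word k) l"
  have "distinct ?l" "set ?l = pverts (odd_graph k)"
    using l bij_betw_vertex_of_word[of k] by (simp_all add: distinct_map bij_betw_def)
  moreover have "3 \<le> length ?l"
  proof -
    obtain t where t: "t \<in> trees k"
      using l(1,3) UN_path_trees[of k] by (cases l) auto
    then have "set (path t) \<subseteq> set l" using l(3) UN_path_trees[of k] by blast
    then have "length (path t) \<le> length l"
      using distinct_path l(2) by (metis card_mono distinct_card finite_set)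
    then show ?thesis using t assms(2) by (simp add: length_path)
  qed
  moreover have "(a, b) \<in> parcs (odd_graph k)" if ab: "{a, b} \<in> cycle_edges ?l" for a b
  proof -
    from ab obtain s where s: "s \<in> cycle_edges l" "{a, b} = vertex_of_word k ` s"
      unfolding cycle_edges_map[OF l(1)] by (rule imageE)
    have "s \<subseteq> middle_words k"
      using s(1) Union_cycle_edges_subset[OF l(1)] l(3) by blast
    with s l(4) show ?thesis
      by (intro parcs_odd_graph_of_word_edge) auto
  qed
  ultimately show ?thesis
    using hamilton_cycle_vwalk_arcs by blast
qed

section \<open>Gluing all cycles\<close>

abbreviation twig :: btree where
  "twig \<equiv> Node Leaf Leaf"

primrec chain :: "nat \<Rightarrow> btree" where
  "chain 0 = Leaf"
| "chain (Suc n) = Node Leaf (chain n)"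

definition nodes :: "btree set \<Rightarrow> btree set \<Rightarrow> btree set" where
  "nodes X F = {Node w v | w v. w \<in> X \<and> v \<in> F}"

definition left_copies :: "edge set \<Rightarrow> btree set \<Rightarrow> edge set" where
  "left_copies C V = {InL e v | e v. e \<in> C \<and> v \<in> V}"

definition trees_left :: "nat \<Rightarrow> nat set \<Rightarrow> btree set" where
  "trees_left N I = {Node w v | w v. size w \<in> I \<and> size w + size v = N}"

lemma size_chain [simp]: "size (chain n) = n"
  by (induction n) auto

lemma word_chain_snoc: "word (chain n) @ [True, False] = True # False # word (chain n)"
  by (induction n) auto

lemma rev_compl_word_chain [simp]: "rev_compl (word (chain n)) = word (chain n)"
  by (induction n) (auto simp: word_chain_snoc)

lemma finite_trees: "finite (trees m)"
proof (rule finite_imageD)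
  have "word ` trees m \<subseteq> {y. set y \<subseteq> UNIV \<and> length y = 2 * m}"
    by auto
  then show "finite (word ` trees m)"
    by (rule finite_subset) (rule finite_lists_length_eq, simp)
qed (simp add: inj_on_def)

lemma nodes_singleton:
  "nodes {w} F = Node w ` F" "nodes X {v} = (\<lambda>w. Node w v) ` X"
  by (auto simp: nodes_def)

lemma trees_left_Un: "trees_left N I \<union> trees_left N J = trees_left N (I \<union> J)"
  by (auto simp: trees_left_def)

lemma trees_left_disjoint: "I \<inter> J = {} \<Longrightarrow> trees_left N I \<inter> trees_left N J = {}"
  by (auto simp: trees_left_def)

lemma trees_left_single: "a \<le> N \<Longrightarrow> trees_left N {a} = nodes (trees a) (trees (N - a))"
  by (auto simp: trees_left_def nodes_def)

lemma trees_Suc: "trees (Suc N) = trees_left N {0..N}"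
proof -
  have "t \<in> trees (Suc N) \<longleftrightarrow> t \<in> trees_left N {0..N}" for t
    by (cases t) (auto simp: trees_left_def)
  then show ?thesis by blast
qed

lemma trees_0: "trees 0 = {Leaf}"
proof -
  have "size t = 0 \<longleftrightarrow> t = Leaf" for t :: btree by (cases t) auto
  then show ?thesis by (simp add: trees_def)
qed

lemma trees_1: "trees (Suc 0) = {twig}"
  by (simp add: trees_Suc trees_left_single trees_0 nodes_singleton)

lemma trees_2: "trees 2 = {Node Leaf twig, Node twig Leaf}"
proof -
  have "{0..1} = {0} \<union> {1::nat}" by auto
  then have "trees 2 = trees_left 1 {0} \<union> trees_left 1 {1}"
    using trees_Suc[of 1] by (simp only: trees_left_Un Suc_1)
  then show ?thesis
    by (simp add: trees_left_single trees_0 trees_1 nodes_singleton insert_commute)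
qed

lemma trees_3: "trees 3 = Node Leaf ` trees 2 \<union> {Node twig twig} \<union> (\<lambda>w. Node w Leaf) ` trees 2"
proof -
  have "{0..2} = {0} \<union> {Suc 0} \<union> {2::nat}" by auto
  then have "trees 3 = trees_left 2 {0} \<union> trees_left 2 {Suc 0} \<union> trees_left 2 {2}"
    using trees_Suc[of 2] by (simp add: trees_left_Un numeral_3_eq_3)
  then show ?thesis
    by (simp add: trees_left_single trees_0 trees_1 nodes_singleton)
qed

lemma trees_4: "trees 4 = Node Leaf ` trees 3 \<union> Node twig ` trees 2 \<union>
    (\<lambda>w. Node w twig) ` trees 2 \<union> (\<lambda>w. Node w Leaf) ` trees 3"
proof -
  have "{0..3} = {0} \<union> {Suc 0} \<union> {2} \<union> {3::nat}" by auto
  then have "trees 4 =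
      trees_left 3 {0} \<union> trees_left 3 {Suc 0} \<union> trees_left 3 {2} \<union> trees_left 3 {3}"
    using trees_Suc[of 3] by (simp only: trees_left_Un Suc_numeral add_num_simps)
  then show ?thesis
    by (simp add: trees_left_single trees_0 trees_1 nodes_singleton)
qed

lemma feeds_InR: "feeds e f \<Longrightarrow> feeds (InR w e) (InR w f)"
  by (simp add: feeds_def)

lemma feeds_InL: "feeds e f \<Longrightarrow> feeds (InL f v) (InL e v)"
  by (simp add: feeds_def covered_append_right covered_rev_compl)

lemma linked_InR:
  assumes "linked X A" "B \<subseteq> edge_tree -` Node w ` X" "InR w -` B \<subseteq> A"
  shows "linked (Node w ` X) B"
  by (rule glued_image(1)[OF _ _ _ _ assms(1)])
    (use assms(2,3) in \<open>auto simp: inj_def intro: feeds_InR\<close>)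

lemma linked_InL:
  assumes "linked X A" "B \<subseteq> edge_tree -` (\<lambda>w. Node w v) ` X" "(\<lambda>e. InL e v) -` B \<subseteq> A"
  shows "linked ((\<lambda>w. Node w v) ` X) B"
  by (rule glued_image(1)[OF _ _ _ _ glued_conversep(1)[OF assms(1)]])
    (use assms(2,3) in \<open>auto simp: inj_def intro: feeds_InL\<close>)

lemma linked_gluing_sequence:
  assumes "gluing_sequence edge_tree feeds {t} {} ess"
    and "X = insert t (edge_tree ` set (concat ess))"
    and "A \<subseteq> edge_tree -` X - set (concat ess)"
  shows "linked X A"
  using glued_gluing_sequence[OF glued_single assms(1)] assms(2,3)
  by (auto elim: glued_antimono)

lemma linked_attach_fibre:
  assumes feeds: "feeds e (Rise x v)" "feeds (Rise x v) (InL g v)" "feeds (InL g v) e"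
    and M: "linked M (insert e A)" "e \<notin> A"
    and X: "linked X C" "x \<in> X" and Y: "linked Y (insert g D)" "g \<notin> D"
    and disjoint: "X \<inter> Y = {}" "M \<inter> nodes (X \<union> Y) {v} = {}"
  shows "linked (M \<union> nodes (X \<union> Y) {v}) (A \<union> left_copies (C \<union> D) {v})"
proof -
  let ?n = "\<lambda>w. Node w v"
  have "C \<subseteq> edge_tree -` X" "insert g D \<subseteq> edge_tree -` Y"
    using X Y glued_subset_vimage(1) by blast+
  then have left: "linked (?n ` X) (insert (Rise x v) (left_copies C {v}))"
      "linked (?n ` Y) (insert (InL g v) (left_copies D {v}))"
    using X(2) by (auto intro!: linked_InL[OF X(1)] linked_InL[OF Y(1)] simp: left_copies_def)
  have "linked (M \<union> ?n ` X \<union> ?n ` Y) (A \<union> left_copies C {v} \<union> left_copies D {v})"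
    by (rule glued_Un3[OF M(1) left feeds])
      (use M(2) Y(2) disjoint in \<open>auto simp: nodes_def left_copies_def\<close>)
  moreover have "M \<union> ?n ` X \<union> ?n ` Y = M \<union> nodes (X \<union> Y) {v}"
    "A \<union> left_copies C {v} \<union> left_copies D {v} = A \<union> left_copies (C \<union> D) {v}"
    by (auto simp: nodes_def left_copies_def)
  ultimately show ?thesis by simp
qed

lemma linked_attach_fibres:
  assumes feeds: "\<And>v. feeds (e v) (Rise x v)" "\<And>v. feeds (Rise x v) (InL g v)"
      "\<And>v. feeds (InL g v) (e v)"
    and X: "linked X C" "x \<in> X" and Y: "linked Y (insert g D)" "g \<notin> D" and "X \<inter> Y = {}"
    and V: "finite V" "inj_on e V"
    and M: "linked M (A \<union> e ` V)" "A \<inter> e ` V = {}" "M \<inter> nodes (X \<union> Y) V = {}"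
  shows "linked (M \<union> nodes (X \<union> Y) V) (A \<union> left_copies (C \<union> D) V)"
  using V M
proof (induction V arbitrary: M A rule: finite_induct)
  case empty
  then show ?case by (simp add: nodes_def left_copies_def)
next
  case (insert v V)
  let ?M = "M \<union> nodes (X \<union> Y) {v}" and ?A = "A \<union> left_copies (C \<union> D) {v}"
  have "linked ?M (A \<union> e ` V \<union> left_copies (C \<union> D) {v})"
    using insert.prems insert.hyps
    by (intro linked_attach_fibre[OF feeds _ _ X Y \<open>X \<inter> Y = {}\<close>]) (auto simp: nodes_def)
  then have "linked ?M (?A \<union> e ` V)"
    by (simp add: Un_ac)
  moreover have "?A \<inter> e ` V = {}"
  proof -
    have "e ` V \<subseteq> edge_tree -` M"
      using glued_subset_vimage(1)[OF insert.prems(2)] by blast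
    moreover have "left_copies (C \<union> D) {v} \<subseteq> edge_tree -` nodes (X \<union> Y) {v}"
      using glued_subset_vimage(1)[OF X(1)] glued_subset_vimage(1)[OF Y(1)]
      by (auto simp: left_copies_def nodes_def)
    moreover have "M \<inter> nodes (X \<union> Y) {v} = {}" "A \<inter> e ` V = {}"
      using insert.prems by (auto simp: nodes_def)
    ultimately show ?thesis by blast
  qed
  moreover have "?M \<inter> nodes (X \<union> Y) V = {}"
    using insert.prems(4) insert.hyps(2) by (auto simp: nodes_def)
  ultimately have "linked (?M \<union> nodes (X \<union> Y) V) (?A \<union> left_copies (C \<union> D) V)"
    using insert.prems(1) by (intro insert.IH) auto
  moreover have "nodes (X \<union> Y) {v} \<union> nodes (X \<union> Y) V = nodes (X \<union> Y) (insert v V)"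
    "left_copies (C \<union> D) {v} \<union> left_copies (C \<union> D) V = left_copies (C \<union> D) (insert v V)"
    by (auto simp: nodes_def left_copies_def)
  ultimately show ?case by (simp add: Un_assoc)
qed

text \<open>These edges of \<open>chain (n + 2)\<close> are needed for the gluings of larger trees.\<close>
definition reserved :: "nat \<Rightarrow> edge set" where
  "reserved n = {Rise Leaf (chain (n + 1)), InR Leaf (Rise Leaf (chain n))}"

definition linkable :: "nat \<Rightarrow> bool" where
  "linkable n \<longleftrightarrow> linked (trees (n + 2)) (reserved n)"

text \<open>
  Both parts are attached to the trees with smaller left subtrees along \<open>Rise (chain (n + 2)) v\<close> and a copy
  of \<open>Cross twig (chain n)\<close>; the copy of \<open>Rise Leaf (chain (n + 1))\<close> then serves to attach the next class.
\<close>
definition bilinkable :: "nat \<Rightarrow> bool" where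
  "bilinkable n \<longleftrightarrow> (\<exists>X Y. X \<union> Y = trees (n + 2) \<and> X \<inter> Y = {} \<and>
     linked X {Rise Leaf (chain (n + 1))} \<and> linked Y {Cross twig (chain n)})"

lemma bilinkable_0: "bilinkable 0"
  unfolding bilinkable_def add_0 trees_2
  by (intro exI[of _ "{Node Leaf twig}"] exI[of _ "{Node twig Leaf}"])
    (auto intro: glued_single)

lemma feeds_left_Suc:
  "feeds (InL (Rise Leaf (chain n)) (Node Leaf v)) (Rise (chain (n + 2)) v)"
  "feeds (Rise (chain (n + 2)) v) (InL (Cross twig (chain n)) v)"
  "feeds (InL (Cross twig (chain n)) v) (InL (Rise Leaf (chain n)) (Node Leaf v))"
  by (simp_all add: feeds_def)

lemma linked_attach_left_Suc:
  assumes "linked M (A \<union> left_copies {Rise Leaf (chain n)} (Node Leaf ` V))"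
    and "A \<inter> left_copies {Rise Leaf (chain n)} (Node Leaf ` V) = {}"
    and "bilinkable n" "finite V" "M \<inter> nodes (trees (n + 2)) V = {}"
  shows "linked (M \<union> nodes (trees (n + 2)) V) (A \<union> left_copies {Rise Leaf (chain (n + 1))} V)"
proof -
  let ?e = "\<lambda>v. InL (Rise Leaf (chain n)) (Node Leaf v)"
  obtain X Y where XY: "X \<union> Y = trees (n + 2)" "X \<inter> Y = {}"
    and X: "linked X {Rise Leaf (chain (n + 1))}" and Y: "linked Y {Cross twig (chain n)}"
    using assms(3) unfolding bilinkable_def by blast
  have copies: "left_copies {Rise Leaf (chain n)} (Node Leaf ` V) = ?e ` V"
    by (auto simp: left_copies_def)
  have "chain (n + 2) \<in> X"
    using glued_subset_vimage(1)[OF X] by simp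
  from linked_attach_fibres[where e = ?e and D = "{}", OF feeds_left_Suc X this Y _ XY(2) assms(4)]
  show ?thesis
    using assms(1,2,5) by (simp add: copies XY(1) inj_on_def)
qed

lemma linked_trees_left:
  assumes "linked (trees_left N {c..n + 1}) (A \<union> left_copies {Rise Leaf (chain n)} (trees (N - (n + 1))))"
    and "c \<le> n + 1" "n + 1 \<le> N" "\<And>e v. InL e v \<notin> A"
    and bilinkable: "\<And>i. i + 2 \<le> N \<Longrightarrow> bilinkable i"
  shows "linked (trees_left N {c..N}) A"
  using assms(1-3)
proof (induction "N - (n + 1)" arbitrary: n)
  case 0
  then show ?case by (auto elim: glued_antimono)
next
  case (Suc b)
  then have N: "N = n + 2 + b" by simp
  let ?M = "trees_left N {c..n + 1}"
  have step: "trees_left N {n + 2} = nodes (trees (n + 2)) (trees b)"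
    by (simp add: trees_left_single N)
  have "linked (?M \<union> nodes (trees (n + 2)) (trees b)) (A \<union> left_copies {Rise Leaf (chain (n + 1))} (trees b))"
  proof (rule linked_attach_left_Suc)
    show "linked ?M (A \<union> left_copies {Rise Leaf (chain n)} (Node Leaf ` trees b))"
      by (rule glued_antimono(1)[OF Suc.prems(1)]) (auto simp: left_copies_def N)
    show "A \<inter> left_copies {Rise Leaf (chain n)} (Node Leaf ` trees b) = {}"
      using assms(4) by (auto simp: left_copies_def)
    show "?M \<inter> nodes (trees (n + 2)) (trees b) = {}"
      unfolding step[symmetric] by (rule trees_left_disjoint) simp
  qed (auto intro: bilinkable finite_trees simp: N)
  moreover have "?M \<union> nodes (trees (n + 2)) (trees b) = trees_left N {c..n + 1 + 1}"
  proof -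
    have "{c..n + 1} \<union> {n + 2} = {c..n + 1 + 1}"
      using Suc.prems(2) by auto
    then show ?thesis by (simp only: step[symmetric] trees_left_Un)
  qed
  moreover have "N - (n + 1 + 1) = b"
    by (simp add: N)
  ultimately have "linked (trees_left N {c..n + 1 + 1})
      (A \<union> left_copies {Rise Leaf (chain (n + 1))} (trees (N - (n + 1 + 1))))"
    by metis
  then show ?case
    using Suc.hyps(1)[of "n + 1"] Suc.prems(2) by (simp add: N)
qed

lemma trees_left_0: "trees_left N {0} = Node Leaf ` trees N"
  by (simp add: trees_left_single trees_0 nodes_singleton)

lemma trees_left_1: "0 < N \<Longrightarrow> trees_left N {1} = Node twig ` trees (N - 1)"
  by (simp add: trees_left_single trees_1 nodes_singleton)

lemma bilinkable_step:
  assumes "linked (trees (n + 1)) {}" "linked (trees n) {}" "\<And>i. i < n \<Longrightarrow> bilinkable i"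
  shows "bilinkable n"
proof -
  let ?X = "trees_left (n + 1) {0}" and ?Y = "trees_left (n + 1) {1..n + 1}"
  have "linked ?X {Rise Leaf (chain (n + 1))}"
    unfolding trees_left_0 by (rule linked_InR[OF assms(1)]) auto
  moreover have "linked ?Y {Cross twig (chain n)}"
  proof (rule linked_trees_left)
    have "linked (trees_left (n + 1) {1})
        ({Cross twig (chain n)} \<union> left_copies {Rise Leaf Leaf} (trees n))"
      by (auto intro!: linked_InR[OF assms(2)] simp: left_copies_def trees_left_1[simplified])
    then show "linked (trees_left (n + 1) {1..0 + 1})
        ({Cross twig (chain n)} \<union> left_copies {Rise Leaf (chain 0)} (trees (n + 1 - (0 + 1))))"
      by simp
  qed (use assms(3) in auto)
  moreover have "?X \<union> ?Y = trees (n + 2)"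
  proof -
    have "{0} \<union> {1..n + 1} = {0..n + 1}" by auto
    then show ?thesis
      using trees_Suc[of "n + 1"] by (simp add: trees_left_Un)
  qed
  moreover have "?X \<inter> ?Y = {}"
    by (rule trees_left_disjoint) simp
  ultimately show ?thesis
    unfolding bilinkable_def by blast
qed

lemma feeds_left_0_2:
  "feeds (Rise Leaf (Node twig v)) (Rise (Node Leaf twig) v)"
  "feeds (Rise (Node Leaf twig) v) (InL (InL (Cross Leaf Leaf) Leaf) v)"
  "feeds (InL (InL (Cross Leaf Leaf) Leaf) v) (Rise Leaf (Node twig v))"
  by (simp_all add: feeds_def)

lemma linked_trees_left_0_2:
  assumes "linkable n"
  shows "linked (trees_left (n + 2) {0, 2})
    (reserved (n + 1) \<union> left_copies {Rise Leaf (chain 1), InL (Rise Leaf Leaf) Leaf} (trees n))"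
proof -
  let ?e = "\<lambda>v. Rise Leaf (Node twig v)"
  have "linked (trees_left (n + 2) {0}) (reserved (n + 1) \<union> ?e ` trees n)"
    unfolding trees_left_0
    by (rule linked_InR[OF assms[unfolded linkable_def]]) (auto simp: reserved_def)
  moreover have two: "trees_left (n + 2) {2} = nodes ({Node Leaf twig} \<union> {Node twig Leaf}) (trees n)"
    by (simp add: trees_left_single trees_2 insert_commute)
  moreover have "trees_left (n + 2) {0} \<inter> trees_left (n + 2) {2} = {}"
    by (rule trees_left_disjoint) simp
  ultimately have "linked (trees_left (n + 2) {0} \<union> trees_left (n + 2) {2}) (reserved (n + 1) \<union>
      left_copies ({Rise Leaf (chain 1)} \<union> {InL (Rise Leaf Leaf) Leaf}) (trees n))"
    unfolding two
    by (intro linked_attach_fibres[OF feeds_left_0_2])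
      (auto intro!: glued_single finite_trees simp: inj_on_def reserved_def)
  then show ?thesis
    unfolding trees_left_Un Un_insert_left Un_empty_left .
qed

lemma feeds_left_2_1_3:
  "feeds (InL (InL (Rise Leaf Leaf) Leaf) (Node Leaf v)) (InR twig (InR Leaf (Rise Leaf v)))"
  "feeds (InR twig (InR Leaf (Rise Leaf v))) (Cross (Node twig twig) v)"
  "feeds (Cross (Node twig twig) v) (InL (InL (Rise Leaf Leaf) Leaf) (Node Leaf v))"
  by (simp_all add: feeds_def)

lemma linked_trees_left_0_1_2:
  assumes "linkable (n + 2)" "linkable (n + 1)" "linkable 1"
  defines "v \<equiv> chain (n + 1)"
  shows "linked (trees_left (n + 4) {0, 1, 2} \<union> nodes (trees 3) {v})
    (reserved (n + 3) \<union> left_copies {Rise Leaf (chain 1)} (trees (n + 2) - {Node Leaf v}) \<union>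
     left_copies {Rise Leaf (chain 2)} {v})" (is "linked _ (?C \<union> ?D)")
proof -
  let ?e = "InL (InL (Rise Leaf Leaf) Leaf) (Node Leaf v)"
    and ?f = "InR twig (InR Leaf (Rise Leaf v))" and ?g = "Cross (Node twig twig) v"
  have "linked (trees_left (n + 4) {0, 2}) (reserved (n + 3) \<union>
      left_copies {Rise Leaf (chain 1), InL (Rise Leaf Leaf) Leaf} (trees (n + 2)))"
    using linked_trees_left_0_2[OF assms(1)] by (simp add: numeral_eq_Suc)
  then have left_0_2: "linked (trees_left (n + 4) {0, 2}) (insert ?e ?C)"
    by (rule glued_antimono) (auto simp: left_copies_def v_def)
  have left_1: "linked (trees_left (n + 4) {1}) {?f}"
  proof -
    have "linked (Node twig ` trees (n + 1 + 2)) {?f}"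
      by (rule linked_InR[OF assms(2)[unfolded linkable_def]]) (auto simp: reserved_def v_def)
    then show ?thesis by (simp add: trees_left_1[simplified] numeral_eq_Suc)
  qed
  have left_3: "linked (nodes (trees 3) {v}) (insert ?g ?D)"
  proof -
    have "linked (trees 3) (reserved 1)"
      using assms(3) by (simp add: linkable_def numeral_eq_Suc)
    then show ?thesis
      unfolding nodes_singleton
      by (rule linked_InL) (auto simp: left_copies_def reserved_def numeral_eq_Suc)
  qed
  have "linked (trees_left (n + 4) {0, 2} \<union> trees_left (n + 4) {1} \<union> nodes (trees 3) {v})
      (?C \<union> {} \<union> ?D)"
    by (rule glued_Un3[OF left_0_2 left_1 left_3 feeds_left_2_1_3])
      (auto simp: left_copies_def reserved_def trees_left_def nodes_def)
  then show ?thesis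
    by (simp add: trees_left_Un insert_commute)
qed

lemma linked_trees_left_0_3:
  assumes "linkable (n + 2)" "linkable (n + 1)" "linkable 1" "bilinkable 1"
  shows "linked (trees_left (n + 4) {0..3})
    (reserved (n + 3) \<union> left_copies {Rise Leaf (chain 2)} (trees (n + 1)))"
proof -
  let ?v = "chain (n + 1)" and ?V = "trees (n + 1) - {chain (n + 1)}"
  let ?M = "trees_left (n + 4) {0, 1, 2} \<union> nodes (trees 3) {?v}"
    and ?A = "reserved (n + 3) \<union> left_copies {Rise Leaf (chain 2)} {?v}"
  have "linked ?M (?A \<union> left_copies {Rise Leaf (chain 1)} (Node Leaf ` ?V))"
    by (rule glued_antimono(1)[OF linked_trees_left_0_1_2[OF assms(1-3)]])
      (auto simp: left_copies_def)
  then have "linked (?M \<union> nodes (trees (1 + 2)) ?V)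
      (?A \<union> left_copies {Rise Leaf (chain (1 + 1))} ?V)"
    by (rule linked_attach_left_Suc[OF _ _ assms(4)])
      (auto simp: left_copies_def reserved_def trees_left_def nodes_def finite_trees)
  moreover have "?M \<union> nodes (trees (1 + 2)) ?V = trees_left (n + 4) {0..3}"
  proof -
    have "nodes (trees 3) {?v} \<union> nodes (trees (1 + 2)) ?V = trees_left (n + 4) {3}"
      by (auto simp: nodes_def trees_left_def)
    moreover have "{0, 1, 2} \<union> {3} = {0..3::nat}" by auto
    ultimately show ?thesis by (simp only: Un_assoc trees_left_Un)
  qed
  moreover have "?A \<union> left_copies {Rise Leaf (chain (1 + 1))} ?V =
      reserved (n + 3) \<union> left_copies {Rise Leaf (chain 2)} (trees (n + 1))"
    by (auto simp: left_copies_def numeral_eq_Suc)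
  ultimately show ?thesis by simp
qed

lemma linkable_step:
  assumes "linkable (n + 2)" "linkable (n + 1)" "linkable 1" "\<And>i. i \<le> n + 2 \<Longrightarrow> bilinkable i"
  shows "linkable (n + 3)"
proof -
  have "bilinkable 1" by (rule assms(4)) simp
  from linked_trees_left_0_3[OF assms(1-3) this]
  have "linked (trees_left (n + 4) {0..n + 4}) (reserved (n + 3))"
    by (intro linked_trees_left[where n = 2]) (auto intro: assms(4) simp: reserved_def)
  then show ?thesis
    using trees_Suc[of "n + 4"] by (simp add: linkable_def numeral_eq_Suc)
qed

lemma chain_3: "chain 3 = Node Leaf (Node Leaf twig)"
  by (simp add: numeral_eq_Suc)

lemma chain_4: "chain 4 = Node Leaf (Node Leaf (Node Leaf twig))"
  by (simp add: numeral_eq_Suc)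

lemma linkableI:
  assumes "gluing_sequence edge_tree feeds {t} {} ess"
    and "trees m = insert t (edge_tree ` set (concat ess))" "m = n + 2"
    and "Rise Leaf (chain (n + 1)) \<notin> set (concat ess)"
    and "InR Leaf (Rise Leaf (chain n)) \<notin> set (concat ess)"
  shows "linkable n"
  unfolding linkable_def \<open>m = n + 2\<close>[symmetric]
  using assms(1,2) by (rule linked_gluing_sequence) (use assms(2-5) in \<open>auto simp: reserved_def\<close>)

lemma bilinkableI:
  assumes "gluing_sequence edge_tree feeds {t} {} ess"
    and "trees m = insert (chain m) (insert t (edge_tree ` set (concat ess)))" "m = n + 2"
    and "chain m \<notin> insert t (edge_tree ` set (concat ess))"
    and "Node twig (chain n) \<in> insert t (edge_tree ` set (concat ess))"
    and "Cross twig (chain n) \<notin> set (concat ess)"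
  shows "bilinkable n"
proof -
  let ?Y = "insert t (edge_tree ` set (concat ess))"
  have "linked {chain m} {Rise Leaf (chain (n + 1))}"
    by (rule glued_single) (simp add: assms(3))
  moreover have "linked ?Y {Cross twig (chain n)}"
    using assms(1) by (rule linked_gluing_sequence) (use assms(5,6) in auto)
  moreover have "{chain m} \<union> ?Y = trees (n + 2)" "{chain m} \<inter> ?Y = {}"
    using assms(2-4) by auto
  ultimately show ?thesis
    unfolding bilinkable_def by blast
qed

text \<open>The gluing sequences for the trees of size 3 and 4 were found by a computer search.\<close>
lemma linkable_1: "linkable 1"
proof (rule linkableI)
  let ?ess =
    "[[InR Leaf (InR Leaf (Rise Leaf Leaf)), Cross (Node twig Leaf) Leaf, InL (Rise Leaf Leaf) twig],
      [InL (InL (Cross Leaf Leaf) Leaf) Leaf, Rise Leaf (Node twig Leaf), Rise (Node Leaf twig) Leaf]]"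
  show "gluing_sequence edge_tree feeds {Node Leaf (Node Leaf twig)} {} ?ess"
    by (simp add: feeds_def)
  show "trees 3 = insert (Node Leaf (Node Leaf twig)) (edge_tree ` set (concat ?ess))"
    by (auto simp: trees_3 trees_2)
qed (simp_all add: numeral_eq_Suc)

lemma bilinkable_1: "bilinkable 1"
proof (rule bilinkableI)
  let ?ess =
    "[[InL (Cross Leaf Leaf) twig, Rise Leaf (Node twig Leaf), Rise (Node Leaf twig) Leaf,
       InL (Cross twig Leaf) Leaf]]"
  show "gluing_sequence edge_tree feeds {Node twig twig} {} ?ess"
    by (simp add: feeds_def)
  show "trees 3 = insert (chain 3) (insert (Node twig twig) (edge_tree ` set (concat ?ess)))"
    by (auto simp: trees_3 trees_2 chain_3)
qed (simp_all add: numeral_eq_Suc)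

lemma linkable_2: "linkable 2"
proof (rule linkableI)
  let ?ess =
    "[[InR Leaf (Cross Leaf (Node Leaf twig)), Cross Leaf (Node (Node twig Leaf) Leaf),
       Rise (Node twig twig) Leaf, InR Leaf (InR Leaf (InL (Cross Leaf Leaf) Leaf))],
      [InR Leaf (InR Leaf (Rise Leaf twig)), Cross (Node twig Leaf) twig,
       InL (Rise Leaf Leaf) (Node Leaf twig)],
      [InL (Rise twig Leaf) twig, InR Leaf (InL (Cross Leaf Leaf) twig), Cross (Node Leaf twig) twig],
      [InR (Node twig Leaf) (Cross Leaf Leaf), Cross (Node Leaf (Node twig Leaf)) Leaf,
       InL (InL (InR Leaf (Rise Leaf Leaf)) Leaf) Leaf],
      [Cross Leaf (Node twig twig), Rise (Node (Node twig Leaf) Leaf) Leaf,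
       InR Leaf (InL (Cross Leaf twig) Leaf)],
      [InL (InL (Rise Leaf twig) Leaf) Leaf, InR twig (InL (Cross Leaf Leaf) Leaf),
       Cross (Node Leaf (Node Leaf twig)) Leaf]]"
  show "gluing_sequence edge_tree feeds {Node Leaf (Node Leaf (Node Leaf twig))} {} ?ess"
    by (simp add: feeds_def)
  show "trees 4 = insert (Node Leaf (Node Leaf (Node Leaf twig))) (edge_tree ` set (concat ?ess))"
    by (auto simp: trees_4 trees_3 trees_2)
qed (simp_all add: numeral_eq_Suc)

lemma bilinkable_2: "bilinkable 2"
proof (rule bilinkableI)
  let ?ess =
    "[[InR twig (Cross Leaf twig), Cross (Node Leaf twig) twig, InL (InL (Rise Leaf Leaf) Leaf) twig],
      [InR (Node Leaf twig) (Cross Leaf Leaf), Cross (Node twig twig) Leaf,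
       InL (InL (InL (Cross Leaf Leaf) Leaf) Leaf) Leaf],
      [InR (Node twig Leaf) (Cross Leaf Leaf), Cross (Node Leaf (Node twig Leaf)) Leaf,
       InL (InL (InR Leaf (Rise Leaf Leaf)) Leaf) Leaf],
      [InL (InL (Rise Leaf twig) Leaf) Leaf, InR twig (InL (Cross Leaf Leaf) Leaf),
       Cross (Node Leaf (Node Leaf twig)) Leaf],
      [Rise (Node Leaf (Node twig Leaf)) Leaf, InR Leaf (InL (InL (Cross Leaf Leaf) Leaf) Leaf),
       Cross Leaf (Node Leaf (Node twig Leaf))],
      [InR Leaf (InL (InL (Rise Leaf Leaf) Leaf) Leaf), InR Leaf (InR twig (Cross Leaf Leaf)),
       InR Leaf (Cross (Node Leaf twig) Leaf)]]"
  show "gluing_sequence edge_tree feeds {Node twig (Node Leaf twig)} {} ?ess"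
    by (simp add: feeds_def)
  show "trees 4 = insert (chain 4) (insert (Node twig (Node Leaf twig)) (edge_tree ` set (concat ?ess)))"
    by (auto simp: trees_4 trees_3 trees_2 chain_4)
qed (simp_all add: numeral_eq_Suc)

lemma linkable_bilinkable: "(0 < n \<longrightarrow> linkable n) \<and> bilinkable n"
proof (induction n rule: less_induct)
  case (less n)
  consider (small) "n \<in> {0, 1, 2}" | (large) "3 \<le> n" by fastforce
  then show ?case
  proof cases
    case large
    then obtain m where n: "n = m + 3"
      using nat_le_iff_add[of 3 n] by (auto simp: add.commute)
    then have IH: "linkable (m + 2)" "linkable (m + 1)" "\<And>i. i < m + 3 \<Longrightarrow> bilinkable i"
      using less.IH by auto
    then have "linked (trees (m + 3 + 1)) {}" "linked (trees (m + 3)) {}"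
      by (auto simp: linkable_def numeral_eq_Suc elim: glued_antimono)
    then show ?thesis
      using linkable_step[OF IH(1,2) linkable_1] bilinkable_step IH(3) by (simp add: n)
  qed (use linkable_1 linkable_2 bilinkable_0 bilinkable_1 bilinkable_2 in auto)
qed

theorem theorem1:
  fixes k :: nat
  assumes "k \<ge> 3"
  shows "\<exists>p. pre_digraph.hamilton_cycle (with_proj (odd_graph k)) p"
proof -
  obtain n where k: "k = n + 2"
    using assms by (auto simp: nat_le_iff_add)
  then have "linkable n"
    using linkable_bilinkable[of n] assms by simp
  then show ?thesis
    using hamilton_cycle_of_linked assms unfolding linkable_def k by simp
qed

end
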